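(* Let $T\subset\mathbb{H}$ and let $r_l\in\mathbb{R}$ for $l=0,1,2,\dots$. Suppose the infinite quaternionic series $\sum_{l=0}^{\infty} r_l p^l$ has the property that $|r_l p^l|\le M_l$, with $M_l\ge 0$, for each $l\in\{0,1,2,\dots\}$ and all $p\in T$. If the series $\sum_{l=0}^{\infty}M_l$ converges, then the series $\sum_{l=0}^{\infty}r_l p^l$ converges uniformly and absolutely on $T$.
   Context: $\mathbb{H}$ is the algebra of quaternions with norm $|p|=\sqrt{x^2+y^2+z^2+u^2}$ for $p=x+yi+zj+uk$. The series $\sum_{l=0}^\infty r_l p^l$ converges if its partial sums $S_n(p)=\sum_{l=0}^n r_l p^l$ converge; it converges absolutely if $\sum_{l=0}^\infty |r_l p^l|$ converges; it converges uniformly on $T$ to $S(p)$ if it converges to $S(p)$ at all $p\in T$ and for every $\epsilon>0$ there is an integer $N_\epsilon>0$ depending only on $\epsilon$ such that $|S_n(p)-S(p)|<\epsilon$ for all $n\ge N_\epsilon$ and all $p\in T$. *)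

theory Defs
  imports "HOL-Analysis.Analysis"
begin

text \<open>The quaternion \<open>Quat x y z u\<close> stands for \<open>x + y i + z j + u k\<close>.\<close>

datatype quat = Quat (qre: real) (qi: real) (qj: real) (qk: real)

lemma quat_eq_iff: "p = q \<longleftrightarrow> qre p = qre q \<and> qi p = qi q \<and> qj p = qj q \<and> qk p = qk q"
  by (auto intro: quat.expand)

instantiation quat :: real_vector
begin

definition zero_quat :: quat where
  "0 = Quat 0 0 0 0"
definition plus_quat :: "quat \<Rightarrow> quat \<Rightarrow> quat" where
  "p + q = Quat (qre p + qre q) (qi p + qi q) (qj p + qj q) (qk p + qk q)"
definition uminus_quat :: "quat \<Rightarrow> quat" where
  "- p = Quat (- qre p) (- qi p) (- qj p) (- qk p)"
definition minus_quat :: "quat \<Rightarrow> quat \<Rightarrow> quat" where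
  "p - q = Quat (qre p - qre q) (qi p - qi q) (qj p - qj q) (qk p - qk q)"
definition scaleR_quat :: "real \<Rightarrow> quat \<Rightarrow> quat" where
  "c *\<^sub>R p = Quat (c * qre p) (c * qi p) (c * qj p) (c * qk p)"

instance
  by standard
    (simp_all add: quat_eq_iff zero_quat_def plus_quat_def uminus_quat_def minus_quat_def
      scaleR_quat_def algebra_simps)

end

lemma quat_sel_simps [simp]:
  "qre 0 = 0" "qi 0 = 0" "qj 0 = 0" "qk 0 = 0"
  "qre (p + q) = qre p + qre q" "qi (p + q) = qi p + qi q"
  "qj (p + q) = qj p + qj q" "qk (p + q) = qk p + qk q"
  "qre (- p) = - qre p" "qi (- p) = - qi p" "qj (- p) = - qj p" "qk (- p) = - qk p"
  "qre (p - q) = qre p - qre q" "qi (p - q) = qi p - qi q"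
  "qj (p - q) = qj p - qj q" "qk (p - q) = qk p - qk q"
  "qre (c *\<^sub>R p) = c * qre p" "qi (c *\<^sub>R p) = c * qi p"
  "qj (c *\<^sub>R p) = c * qj p" "qk (c *\<^sub>R p) = c * qk p"
  by (simp_all add: zero_quat_def plus_quat_def uminus_quat_def minus_quat_def scaleR_quat_def)

instantiation quat :: real_algebra_1
begin

definition one_quat :: quat where
  "1 = Quat 1 0 0 0"

text \<open>The bilinear product determined by \<open>i\<^sup>2 = j\<^sup>2 = k\<^sup>2 = i j k = -1\<close>.\<close>
definition times_quat :: "quat \<Rightarrow> quat \<Rightarrow> quat" where
  "p * q = Quat
     (qre p * qre q - qi p * qi q - qj p * qj q - qk p * qk q)
     (qre p * qi q + qi p * qre q + qj p * qk q - qk p * qj q)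
     (qre p * qj q - qi p * qk q + qj p * qre q + qk p * qi q)
     (qre p * qk q + qi p * qj q - qj p * qi q + qk p * qre q)"

instance
  by standard (simp_all add: quat_eq_iff one_quat_def times_quat_def algebra_simps)

end

lemma quat_one_sel [simp]: "qre 1 = 1" "qi 1 = 0" "qj 1 = 0" "qk 1 = 0"
  by (simp_all add: one_quat_def)

lemma quat_times_sel:
  "qre (p * q) = qre p * qre q - qi p * qi q - qj p * qj q - qk p * qk q"
  "qi (p * q) = qre p * qi q + qi p * qre q + qj p * qk q - qk p * qj q"
  "qj (p * q) = qre p * qj q - qi p * qk q + qj p * qre q + qk p * qi q"
  "qk (p * q) = qre p * qk q + qi p * qj q - qj p * qi q + qk p * qre q"
  by (simp_all add: times_quat_def)

text \<open>The inner product is introduced because the class \<open>real_inner\<close> supplies the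
  triangle inequality for the norm.\<close>

instantiation quat :: real_inner
begin

definition norm_quat :: "quat \<Rightarrow> real" where
  "norm p = sqrt ((qre p)\<^sup>2 + (qi p)\<^sup>2 + (qj p)\<^sup>2 + (qk p)\<^sup>2)"
definition inner_quat :: "quat \<Rightarrow> quat \<Rightarrow> real" where
  "p \<bullet> q = qre p * qre q + qi p * qi q + qj p * qj q + qk p * qk q"
definition sgn_quat :: "quat \<Rightarrow> quat" where
  "sgn (p::quat) = inverse (norm p) *\<^sub>R p"
definition dist_quat :: "quat \<Rightarrow> quat \<Rightarrow> real" where
  "dist (p::quat) q = norm (p - q)"
definition uniformity_quat :: "(quat \<times> quat) filter" where
  "uniformity = (INF e\<in>{0<..}. principal {(p, q). dist (p::quat) q < e})"
definition open_quat :: "quat set \<Rightarrow> bool" where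
  "open (U::quat set) \<longleftrightarrow> (\<forall>p\<in>U. eventually (\<lambda>(p', q). p' = p \<longrightarrow> q \<in> U) uniformity)"

instance
proof
  fix p :: quat
  show "p \<bullet> p = 0 \<longleftrightarrow> p = 0"
  proof
    assume "p \<bullet> p = 0"
    then show "p = 0"
      by (simp add: inner_quat_def quat_eq_iff add_nonneg_eq_0_iff)
  qed (simp add: inner_quat_def)
qed (simp_all add: inner_quat_def norm_quat_def sgn_quat_def dist_quat_def uniformity_quat_def
      open_quat_def power2_eq_square algebra_simps)

end

instantiation quat :: real_normed_div_algebra
begin

definition inverse_quat :: "quat \<Rightarrow> quat" where
  "inverse p = inverse ((norm p)\<^sup>2) *\<^sub>R Quat (qre p) (- qi p) (- qj p) (- qk p)"
definition divide_quat :: "quat \<Rightarrow> quat \<Rightarrow> quat" where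
  "(p::quat) div q = p * inverse q"

instance
proof
  fix p q :: quat
  show "norm (p * q) = norm p * norm q"
    unfolding norm_quat_def quat_times_sel real_sqrt_mult [symmetric]
    by (simp add: power2_eq_square algebra_simps)
  have n: "(norm p)\<^sup>2 = qre p * qre p + qi p * qi p + qj p * qj p + qk p * qk p"
    by (simp add: norm_quat_def power2_eq_square)
  show "inverse p * p = 1" "p * inverse p = 1" if "p \<noteq> 0"
  proof -
    have "inverse ((norm p)\<^sup>2) * (norm p)\<^sup>2 = 1" using that by simp
    then show "inverse p * p = 1" "p * inverse p = 1"
      unfolding n by (simp_all add: inverse_quat_def quat_eq_iff quat_times_sel n algebra_simps)
  qed
  show "p div q = p * inverse q" by (rule divide_quat_def)
  show "inverse (0 :: quat) = 0" by (simp add: inverse_quat_def)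
qed

end

end

theory Submission
  imports Defs
begin

text \<open>This is the Weierstrass M-test. For p in T the blocks of terms between two partial sums
  are bounded by blocks of the sum of the \<open>M l\<close>, independently of p, so the partial
  sums are uniformly Cauchy on T. Completeness of the quaternions, inherited from the reals
  coordinate by coordinate, supplies the limit. Absolute convergence is comparison with
  \<open>M\<close>.\<close>

text \<open>Coordinates appear as inner products because these are bounded linear maps, which
  preserve Cauchy sequences.\<close>

lemma quat_expand_units:
  "p = (p \<bullet> Quat 1 0 0 0) *\<^sub>R Quat 1 0 0 0 + (p \<bullet> Quat 0 1 0 0) *\<^sub>R Quat 0 1 0 0
    + (p \<bullet> Quat 0 0 1 0) *\<^sub>R Quat 0 0 1 0 + (p \<bullet> Quat 0 0 0 1) *\<^sub>R Quat 0 0 0 1"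
  by (simp add: quat_eq_iff inner_quat_def)

text \<open>\<open>Weierstrass_m_test\<close> requires a complete codomain.\<close>

instance quat :: banach
proof
  fix X :: "nat \<Rightarrow> quat"
  assume "Cauchy X"
  then have coord: "convergent (\<lambda>n. X n \<bullet> e)" for e
    using bounded_linear.Cauchy [OF bounded_linear_inner_left] Cauchy_convergent by blast
  have "convergent (\<lambda>n. (X n \<bullet> e) *\<^sub>R e)" for e
    using coord [of e] bounded_linear.tendsto [OF bounded_linear_scaleR_left]
    unfolding convergent_def by blast
  then show "convergent X"
    by (subst quat_expand_units [of "X _", abs_def]) (intro convergent_add)
qed

theorem proposition3p7:
  fixes T :: "quat set" and r M :: "nat \<Rightarrow> real"
  assumes "\<And>l. M l \<ge> 0"
    and "\<And>l p. p \<in> T \<Longrightarrow> norm (r l *\<^sub>R p ^ l) \<le> M l"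
    and "summable M"
  shows "uniformly_convergent_on T (\<lambda>n p. \<Sum>l\<le>n. r l *\<^sub>R p ^ l)
    \<and> (\<forall>p\<in>T. summable (\<lambda>l. norm (r l *\<^sub>R p ^ l)))"
proof
  have "uniform_limit T (\<lambda>n p. \<Sum>l<n. r l *\<^sub>R p ^ l) (\<lambda>p. \<Sum>l. r l *\<^sub>R p ^ l) sequentially"
    using assms(2,3) by (rule Weierstrass_m_test)
  \<comment> \<open>The M-test sums over \<open>l<n\<close>; shifting the index by one gives the
    partial sums up to and including n.\<close>
  then have "uniform_limit T (\<lambda>n p. \<Sum>l<Suc n. r l *\<^sub>R p ^ l) (\<lambda>p. \<Sum>l. r l *\<^sub>R p ^ l) sequentially"
    by (rule filterlim_compose [OF _ filterlim_Suc])
  then show "uniformly_convergent_on T (\<lambda>n p. \<Sum>l\<le>n. r l *\<^sub>R p ^ l)"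
    unfolding lessThan_Suc_atMost by (rule uniformly_convergentI)
  show "\<forall>p\<in>T. summable (\<lambda>l. norm (r l *\<^sub>R p ^ l))"
    using assms(2,3) by (auto intro: summable_comparison_test')
qed

end
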